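(* Let $K$ be a field, let $\mathscr{G}=[0,\ell_1]\times\cdots\times[0,\ell_d]\subseteq\mathbb{Z}^d$ be a $d$-dimensional grid (integer intervals, $\ell_1,\ldots,\ell_d\geq 1$), put $n:=\ell_1+\cdots+\ell_d+1$, let $S_i:=\{x\in\mathscr{G}\mid |x|=i-1\}$ for $i\in\{1,\ldots,n\}$, where $|x|=x_1+\cdots+x_d$, and set $\mathcal{S}=(S_1,\ldots,S_n)$. Then the Jordan filtered rank invariant $\mathbf{rk}^{\mathrm{fil}}_{\mathcal S}$ is strictly finer than the classical rank invariant, in the following sense. (1) Let $M$ and $N$ be two pointwise finite-dimensional $\mathscr{G}$-modules over $K$ (extended trivially, i.e. by zero, to the whole of $\mathbb{Z}^d$). Then $$\mathbf{rk}^0_{M,\mathcal S}=\mathbf{rk}^0_{N,\mathcal S}\iff \mathbf{rk}_M=\mathbf{rk}_N.$$ (2) Assume $d\geq 2$. There are (non-isomorphic) pointwise finite-dimensional $\mathscr{G}$-modules $X$ and $Y$ over $K$ (also extended by zero to $\mathbb{Z}^d$) such that $$\mathbf{rk}^1_{X,\mathcal S}(\mathbf{0},\mathbf{0})\neq\mathbf{rk}^1_{Y,\mathcal S}(\mathbf{0},\mathbf{0})\quad\text{but}\quad\mathbf{rk}_X=\mathbf{rk}_Y.$$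
   Context: $\mathbb{Z}^d$ carries the product order and $\mathscr{G}$ the induced order. For a poset $\mathscr{P}$, a $\mathscr{P}$-module $M$ is a functor from $\mathscr{P}$ to $K$-vector spaces, with spaces $M_x$ and structure maps $M_{yx}=M_{y,x}:M_x\to M_y$ for $x\leq y$; it is pointwise finite-dimensional if all $M_x$ are finite-dimensional. For a $\mathbb{Z}^d$-module $M$ and $x\in\mathbb{Z}^d$, the shift $M[x]$ is given by $(M[x])_z=M_{x+z}$, $(M[x])_{wz}=M_{x+w,x+z}$. The rank invariant of a $\mathbb{Z}^d$-module $M$ is $\mathbf{rk}_M:\mathbb{Z}^d\times\mathbb{Z}^d\to\mathbb{N}\cup\{\infty\}$, with $\mathbf{rk}_M(x,y)=\operatorname{rank}(M_{yx})$ if $x\leq y$ and $\infty$ otherwise. For a sequence $\mathcal{S}=(S_1,\ldots,S_n)$ of pairwise disjoint finite subsets and a $\mathbb{Z}^d$-module $M$, write $M|_{\mathcal S}:=\bigoplus_{x\in\bigcup_iS_i}M_x$. The nilpotent operator $\mathbf{T}_{M,\mathcal{S}}$ on $M|_{\mathcal S}$ is the one which, for each $i\in\{1,\ldots,n-1\}$, maps $\bigoplus_{x\in S_i}M_x$ to $\bigoplus_{y\in S_{i+1}}M_y$ with $(y,x)$-entry equal to $M_{yx}$ if $x<y$ and $0$ otherwise, and which is zero on $\bigoplus_{x\in S_n}M_x$. For $i\in\mathbb{N}$, the $\mathbb{Z}^d$-module $M^i_{\mathcal S}$ is defined by $(M^i_{\mathcal S})_x:=\operatorname{Im}(\mathbf{T}^i_{M[x],\mathcal{S}})\subseteq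 M[x]|_{\mathcal S}=\bigoplus_{z\in\bigcup_jS_j}M_{x+z}$ and, for $x\le y$, $(M^i_{\mathcal S})_{y,x}$ is the restriction of $\bigoplus_zM_{y+z,x+z}$ to $\operatorname{Im}(\mathbf{T}^i_{M[x],\mathcal{S}})$, with values in $\operatorname{Im}(\mathbf{T}^i_{M[y],\mathcal{S}})$. In particular $\mathbf{T}^0$ is the identity. Define $\mathbf{rk}^i_{M,\mathcal S}:=\mathbf{rk}_{M^i_{\mathcal S}}$, and the Jordan filtered rank invariant of $M$ at $\mathcal{S}$ as $\mathbf{rk}^{\mathrm{fil}}_{\mathcal S}(M):=(\mathbf{rk}^i_{M,\mathcal S})_{0\leq i\leq n-1}$. *)

theory Defs
  imports "HOL-Analysis.Finite_Cartesian_Product" "HOL-Library.Function_Algebras"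
    "HOL-Library.Extended_Nat"
begin

definition linear_between ::
    "('k::field \<Rightarrow> 'a::ab_group_add \<Rightarrow> 'a) \<Rightarrow> ('k \<Rightarrow> 'b::ab_group_add \<Rightarrow> 'b) \<Rightarrow>
     'a set \<Rightarrow> 'b set \<Rightarrow> ('a \<Rightarrow> 'b) \<Rightarrow> bool" where
  "linear_between s t U V f \<longleftrightarrow>
     f ` U \<subseteq> V \<and>
     (\<forall>u\<in>U. \<forall>v\<in>U. f (u + v) = f u + f v) \<and>
     (\<forall>c. \<forall>u\<in>U. f (s c u) = t c (f u))"

definition fin_dim :: "('k::field \<Rightarrow> 'a::ab_group_add \<Rightarrow> 'a) \<Rightarrow> 'a set \<Rightarrow> bool" where
  "fin_dim s V \<longleftrightarrow> (\<exists>B. finite B \<and> module.span s B = V)"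

text \<open>The case distinction is needed because \<^const>\<open>vector_space.dim\<close> has a junk value in
  infinite dimension.\<close>

definition rank_on ::
    "('k::field \<Rightarrow> 'a::ab_group_add \<Rightarrow> 'a) \<Rightarrow> 'b set \<Rightarrow> ('b \<Rightarrow> 'a) \<Rightarrow> enat" where
  "rank_on s U f =
     (if fin_dim s (f ` U) then enat (vector_space.dim s (f ` U)) else \<infinity>)"

text \<open>
  The spaces \<open>M\<^sub>x\<close> of a module \<open>M\<close> are subspaces of one ambient vector space, the type \<open>'a\<close>
  with scalar multiplication \<open>scalar M\<close>. This is no restriction: any family of vector spaces
  embeds into its direct sum. The structure map \<open>M\<^sub>x \<rightarrow> M\<^sub>y\<close> is \<open>smap M y x\<close>; only its values
  on \<open>fibre M x\<close> matter.
\<close>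

record ('k, 'p, 'a) pmod =
  scalar :: "'k \<Rightarrow> 'a \<Rightarrow> 'a"
  fibre :: "'p \<Rightarrow> 'a set"
  smap :: "'p \<Rightarrow> 'p \<Rightarrow> 'a \<Rightarrow> 'a"

definition poset_module ::
    "'p::order set \<Rightarrow> ('k::field, 'p, 'a::ab_group_add) pmod \<Rightarrow> bool" where
  "poset_module P M \<longleftrightarrow>
     vector_space (scalar M) \<and>
     (\<forall>x\<in>P. module.subspace (scalar M) (fibre M x)) \<and>
     (\<forall>x\<in>P. \<forall>y\<in>P. x \<le> y \<longrightarrow>
        linear_between (scalar M) (scalar M) (fibre M x) (fibre M y) (smap M y x)) \<and>
     (\<forall>x\<in>P. \<forall>v\<in>fibre M x. smap M x x v = v) \<and>
     (\<forall>x\<in>P. \<forall>y\<in>P. \<forall>z\<in>P. x \<le> y \<longrightarrow> y \<le> z \<longrightarrow>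
        (\<forall>v\<in>fibre M x. smap M z y (smap M y x v) = smap M z x v))"

definition pointwise_fin_dim ::
    "'p::order set \<Rightarrow> ('k::field, 'p, 'a::ab_group_add) pmod \<Rightarrow> bool" where
  "pointwise_fin_dim P M \<longleftrightarrow> (\<forall>x\<in>P. fin_dim (scalar M) (fibre M x))"

definition module_isomorphic ::
    "'p::order set \<Rightarrow> ('k::field, 'p, 'a::ab_group_add) pmod \<Rightarrow>
     ('k, 'p, 'b::ab_group_add) pmod \<Rightarrow> bool" where
  "module_isomorphic P M N \<longleftrightarrow>
     (\<exists>\<phi>. (\<forall>x\<in>P. linear_between (scalar M) (scalar N) (fibre M x) (fibre N x) (\<phi> x) \<and>
                 bij_betw (\<phi> x) (fibre M x) (fibre N x)) \<and>
          (\<forall>x\<in>P. \<forall>y\<in>P. x \<le> y \<longrightarrow>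
             (\<forall>v\<in>fibre M x. \<phi> y (smap M y x v) = smap N y x (\<phi> x v))))"

definition zero_extension ::
    "'p::order set \<Rightarrow> ('k::field, 'p, 'a::ab_group_add) pmod \<Rightarrow> ('k, 'p, 'a) pmod" where
  "zero_extension P M =
     \<lparr>scalar = scalar M,
      fibre = (\<lambda>x. if x \<in> P then fibre M x else {0}),
      smap = (\<lambda>y x v. if x \<in> P \<and> y \<in> P then smap M y x v else 0)\<rparr>"

definition rank_invariant ::
    "('k::field, 'p::order, 'a::ab_group_add) pmod \<Rightarrow> 'p \<Rightarrow> 'p \<Rightarrow> enat" where
  "rank_invariant M x y =
     (if x \<le> y then rank_on (scalar M) (fibre M x) (smap M y x) else \<infinity>)"

definition shift ::
    "int^'d::finite \<Rightarrow> ('k::field, int^'d, 'a::ab_group_add) pmod \<Rightarrow>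
     ('k, int^'d, 'a) pmod" where
  "shift x M =
     \<lparr>scalar = scalar M,
      fibre = (\<lambda>z. fibre M (x + z)),
      smap = (\<lambda>w z. smap M (x + w) (x + z))\<rparr>"

text \<open>
  Below, \<open>S\<close> is a list of pairwise disjoint finite sets. The list index starts at 0, so
  \<open>S ! i\<close> is the member of the sequence usually numbered \<open>i + 1\<close>. Elements of the direct sum
  are functions that vanish outside \<open>\<Union>(set S)\<close>, which is finite.
\<close>

definition direct_sum ::
    "('k::field, 'p::order, 'a::ab_group_add) pmod \<Rightarrow> 'p set list \<Rightarrow> ('p \<Rightarrow> 'a) set" where
  "direct_sum M S =
     {f. (\<forall>x\<in>\<Union>(set S). f x \<in> fibre M x) \<and> (\<forall>x. x \<notin> \<Union>(set S) \<longrightarrow> f x = 0)}"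

text \<open>By disjointness, the outer sum has at most one term; it is empty, and the component at
  \<open>y\<close> therefore zero, if \<open>y\<close> lies in the first set or outside \<open>\<Union>(set S)\<close>.\<close>

definition nilp_op ::
    "('k::field, 'p::order, 'a::ab_group_add) pmod \<Rightarrow> 'p set list \<Rightarrow>
     ('p \<Rightarrow> 'a) \<Rightarrow> ('p \<Rightarrow> 'a)" where
  "nilp_op M S f =
     (\<lambda>y. \<Sum>i | Suc i < length S \<and> y \<in> S ! Suc i.
            \<Sum>x\<in>S ! i. if x < y then smap M y x (f x) else 0)"

definition jordan_module ::
    "nat \<Rightarrow> ('k::field, int^'d::finite, 'a::ab_group_add) pmod \<Rightarrow> (int^'d) set list \<Rightarrow>
     ('k, int^'d, int^'d \<Rightarrow> 'a) pmod" where
  "jordan_module i M S =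
     \<lparr>scalar = (\<lambda>c f z. scalar M c (f z)),
      fibre = (\<lambda>x. (nilp_op (shift x M) S ^^ i) ` direct_sum (shift x M) S),
      smap = (\<lambda>y x f z. if z \<in> \<Union>(set S) then smap M (y + z) (x + z) (f z) else 0)\<rparr>"

definition jordan_rank ::
    "nat \<Rightarrow> ('k::field, int^'d::finite, 'a::ab_group_add) pmod \<Rightarrow> (int^'d) set list \<Rightarrow>
     int^'d \<Rightarrow> int^'d \<Rightarrow> enat" where
  "jordan_rank i M S = rank_invariant (jordan_module i M S)"

definition grid_layers :: "int^'d::finite \<Rightarrow> (int^'d) set list" where
  "grid_layers l =
     (let n = nat (\<Sum>j\<in>UNIV. l $ j) + 1
      in map (\<lambda>i. {x \<in> {0..l}. (\<Sum>j\<in>UNIV. x $ j) = int i - 1}) [1..<n + 1])"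

lemma poset_module_zero_extension:
  assumes M: "poset_module P M"
    and convex: "\<And>x y z. x \<in> P \<Longrightarrow> z \<in> P \<Longrightarrow> x \<le> y \<Longrightarrow> y \<le> z \<Longrightarrow> y \<in> P"
  shows "poset_module UNIV (zero_extension P M)"
proof -
  interpret vector_space "scalar M"
    using M by (simp add: poset_module_def)
  note M' = M[unfolded poset_module_def]
  have sub: "subspace (fibre M x)" if "x \<in> P" for x
    using M'[THEN conjunct2, THEN conjunct1] that by blast
  have lin: "linear_between (scalar M) (scalar M) (fibre M x) (fibre M y) (smap M y x)"
    if "x \<in> P" "y \<in> P" "x \<le> y" for x y
    using M'[THEN conjunct2, THEN conjunct2, THEN conjunct1] that by blast
  have ident: "smap M x x v = v" if "x \<in> P" "v \<in> fibre M x" for x v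
    using M'[THEN conjunct2, THEN conjunct2, THEN conjunct2, THEN conjunct1] that by blast
  have comp: "smap M z y (smap M y x v) = smap M z x v"
    if "x \<in> P" "y \<in> P" "z \<in> P" "x \<le> y" "y \<le> z" "v \<in> fibre M x" for x y z v
    using M'[THEN conjunct2, THEN conjunct2, THEN conjunct2, THEN conjunct2] that by blast
  have zero: "smap M y x 0 = 0" if "x \<in> P" "y \<in> P" "x \<le> y" for x y
  proof -
    have "0 \<in> fibre M x" using sub[OF that(1)] by (rule subspace_0)
    hence "smap M y x (scalar M 0 0) = scalar M 0 (smap M y x 0)"
      using lin[OF that] unfolding linear_between_def by blast
    thus ?thesis by simp
  qed
  let ?E = "zero_extension P M"
  have fib: "fibre ?E x = (if x \<in> P then fibre M x else {0})"
    and map: "smap ?E y x v = (if x \<in> P \<and> y \<in> P then smap M y x v else 0)"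
    and scl: "scalar ?E = scalar M" for x y v
    by (simp_all add: zero_extension_def)
  have "linear_between (scalar M) (scalar M) (fibre ?E x) (fibre ?E y) (smap ?E y x)"
    if "x \<le> y" for x y
  proof (cases "x \<in> P \<and> y \<in> P")
    case True
    thus ?thesis using lin[of x y] that by (simp add: linear_between_def fib map)
  next
    case False
    hence "smap ?E y x v = 0" for v by (auto simp: map)
    moreover have "0 \<in> fibre ?E y" using sub[of y] subspace_0 by (simp add: fib)
    ultimately show ?thesis by (auto simp: linear_between_def)
  qed
  moreover have "subspace (fibre ?E x)" for x
    using sub by (simp add: fib)
  moreover have "smap ?E x x v = v" if "v \<in> fibre ?E x" for x v
    using that ident by (auto simp: fib map split: if_splits)
  moreover have "smap ?E z y (smap ?E y x v) = smap ?E z x v"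
    if "x \<le> y" "y \<le> z" "v \<in> fibre ?E x" for x y z v
  proof (cases "x \<in> P \<and> z \<in> P")
    case True
    hence "y \<in> P" using convex[of x z y] that by blast
    thus ?thesis using True comp[of x y z v] that by (simp add: fib map)
  next
    case False
    thus ?thesis using zero[of y z] that(2) by (auto simp: map)
  qed
  ultimately show ?thesis
    using vector_space_axioms unfolding poset_module_def scl by simp
qed

lemma grid_convex:
  fixes l :: "int^'d::finite"
  shows "x \<in> {0..l} \<Longrightarrow> z \<in> {0..l} \<Longrightarrow> x \<le> y \<Longrightarrow> y \<le> z \<Longrightarrow> y \<in> {0..l}"
  by (auto intro: order_trans)

lemma poset_module_shift:
  fixes x :: "int^'d::finite"
  assumes "poset_module UNIV M"
  shows "poset_module UNIV (shift x M)"
proof -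
  have "x + z \<le> x + w" if "z \<le> w" for z w :: "int^'d"
    using that by (simp add: less_eq_vec_def)
  thus ?thesis
    using assms by (simp add: poset_module_def shift_def)
qed

lemma smap_zero:
  assumes M: "poset_module UNIV M" and "x \<le> y"
  shows "smap M y x 0 = 0"
proof -
  interpret vector_space "scalar M"
    using M by (simp add: poset_module_def)
  have "0 \<in> fibre M x"
    using M by (intro subspace_0) (simp add: poset_module_def)
  moreover have "linear_between (scalar M) (scalar M) (fibre M x) (fibre M y) (smap M y x)"
    using assms by (simp add: poset_module_def)
  ultimately have "smap M y x (scalar M 0 0) = scalar M 0 (smap M y x 0)"
    unfolding linear_between_def by blast
  thus ?thesis by simp
qed

lemma vector_space_pointwise:
  assumes "vector_space s"
  shows "vector_space (\<lambda>c f z. s c (f z))"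
proof -
  interpret vector_space s by fact
  show ?thesis
    by unfold_locales (auto simp: fun_eq_iff scale_right_distrib scale_left_distrib)
qed

lemma subspace_direct_sum:
  assumes M: "poset_module UNIV M"
  shows "module.subspace (\<lambda>c f z. scalar M c (f z)) (direct_sum M S)"
proof -
  interpret vector_space "scalar M"
    using M by (simp add: poset_module_def)
  interpret F: vector_space "\<lambda>c f z. scalar M c (f z)"
    by (rule vector_space_pointwise) (rule vector_space_axioms)
  have sub: "subspace (fibre M x)" for x
    using M by (simp add: poset_module_def)
  show ?thesis
    unfolding F.subspace_def direct_sum_def
    using sub by (auto simp: subspace_0 subspace_add subspace_scale)
qed

lemma linear_nilp_op:
  assumes M: "poset_module UNIV M"
  shows "linear_between (\<lambda>c f z. scalar M c (f z)) (\<lambda>c f z. scalar M c (f z))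
    (direct_sum M S) (direct_sum M S) (nilp_op M S)"
proof -
  interpret vector_space "scalar M"
    using M by (simp add: poset_module_def)
  have sub: "subspace (fibre M x)" for x
    using M by (simp add: poset_module_def)
  have lin: "linear_between (scalar M) (scalar M) (fibre M x) (fibre M y) (smap M y x)"
    if "x < y" for x y
    using M that by (simp add: poset_module_def)
  have val: "f x \<in> fibre M x" if "f \<in> direct_sum M S" "x \<in> S ! i" "Suc i < length S" for f x i
  proof -
    have "x \<in> \<Union>(set S)" using that(2,3) by (meson Suc_lessD UnionI nth_mem)
    thus ?thesis using that(1) unfolding direct_sum_def by blast
  qed
  have "nilp_op M S f \<in> direct_sum M S" if f: "f \<in> direct_sum M S" for f
  proof -
    have "nilp_op M S f y \<in> fibre M y" for y
      unfolding nilp_op_def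
      using lin val[OF f] sub[of y]
      by (intro subspace_sum) (auto simp: linear_between_def image_subset_iff subspace_0)
    moreover have "nilp_op M S f y = 0" if "y \<notin> \<Union>(set S)" for y
    proof -
      have "{i. Suc i < length S \<and> y \<in> S ! Suc i} = {}"
        using that nth_mem by fastforce
      thus ?thesis unfolding nilp_op_def by (simp only: sum.empty)
    qed
    ultimately show ?thesis by (simp add: direct_sum_def)
  qed
  moreover have "nilp_op M S (f + g) = nilp_op M S f + nilp_op M S g"
    if f: "f \<in> direct_sum M S" and g: "g \<in> direct_sum M S" for f g
  proof -
    have "(if x < y then smap M y x ((f + g) x) else 0) =
      (if x < y then smap M y x (f x) else 0) + (if x < y then smap M y x (g x) else 0)"
      if "x \<in> S ! i" "Suc i < length S" for x y i
      using lin val[OF f that] val[OF g that] by (simp add: linear_between_def)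
    thus ?thesis
      by (simp add: nilp_op_def fun_eq_iff flip: sum.distrib)
  qed
  moreover have "nilp_op M S (\<lambda>z. scalar M c (f z)) = (\<lambda>z. scalar M c (nilp_op M S f z))"
    if f: "f \<in> direct_sum M S" for f c
  proof -
    have "(if x < y then smap M y x (scalar M c (f x)) else 0) =
      scalar M c (if x < y then smap M y x (f x) else 0)"
      if "x \<in> S ! i" "Suc i < length S" for x y i
      using lin val[OF f that] by (simp add: linear_between_def)
    thus ?thesis
      by (simp add: nilp_op_def fun_eq_iff scale_sum_right)
  qed
  ultimately show ?thesis
    by (auto simp: linear_between_def)
qed

lemma linear_between_funpow:
  assumes "linear_between s s U U f"
  shows "linear_between s s U U (f ^^ i)"
proof (induction i)
  case 0
  show ?case by (simp add: linear_between_def)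
next
  case (Suc i)
  show ?case
    using assms Suc unfolding linear_between_def by (auto simp: image_subset_iff)
qed

lemma linear_between_subspace_image:
  assumes "vector_space s" and "linear_between s s U U f" and "module.subspace s U"
  shows "module.subspace s (f ` U)"
proof -
  interpret vector_space s by fact
  have U: "subspace U" by fact
  have add: "f u + f v = f (u + v)" and scl: "s c (f u) = f (s c u)"
    if "u \<in> U" "v \<in> U" for u v c
    using assms(2) that by (auto simp: linear_between_def)
  have "0 = f 0"
    using scl[of 0 0 0] subspace_0[OF U] by simp
  thus ?thesis
    using U by (intro subspaceI)
      (auto simp: add scl subspace_add subspace_scale subspace_0 intro!: image_eqI)
qed

text \<open>The transition maps of \<open>\<bigoplus>\<^sub>z M\<^bsub>x+z\<^esub>\<close> commute with the operators.\<close>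

lemma jordan_smap_commutes:
  fixes M :: "('k::field, int^'d::finite, 'a::ab_group_add) pmod" and i :: nat
  assumes M: "poset_module UNIV M" and xy: "x \<le> y"
    and f: "f \<in> direct_sum (shift x M) S"
  defines "h \<equiv> smap (jordan_module i M S) y x"
  shows "h f \<in> direct_sum (shift y M) S"
    and "h (nilp_op (shift x M) S f) = nilp_op (shift y M) S (h f)"
proof -
  have le: "x + z \<le> y + z" for z using xy by (simp add: less_eq_vec_def)
  have lin: "u \<le> v \<Longrightarrow> linear_between (scalar M) (scalar M) (fibre M u) (fibre M v) (smap M v u)" for u v
    using M by (simp add: poset_module_def)
  have comp: "smap M w v (smap M v u a) = smap M w u a" if "u \<le> v" "v \<le> w" "a \<in> fibre M u" for u v w a
    using M that by (auto simp: poset_module_def)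
  have h: "h g z = (if z \<in> \<Union>(set S) then smap M (y + z) (x + z) (g z) else 0)" for g z
    by (simp add: h_def jordan_module_def)
  show "h f \<in> direct_sum (shift y M) S"
    using f lin[OF le]
    by (auto simp: direct_sum_def h shift_def linear_between_def image_subset_iff)
  have fib: "f u \<in> fibre M (x + u)" if "u \<in> \<Union>(set S)" for u
    using f that by (auto simp: direct_sum_def shift_def)
  interpret vector_space "scalar M"
    using M by (simp add: poset_module_def)
  have sub: "subspace (fibre M u)" for u
    using M by (simp add: poset_module_def)
  have smap_sum: "smap M v u (\<Sum>j\<in>J. g j) = (\<Sum>j\<in>J. smap M v u (g j))"
    if "u \<le> v" "\<And>j. j \<in> J \<Longrightarrow> g j \<in> fibre M u" for u v g and J :: "'j set"
    using that(2)
  proof (induction J rule: infinite_finite_induct)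
    case (insert j J)
    have "sum g J \<in> fibre M u" using insert sub by (intro subspace_sum) auto
    thus ?case using insert lin[OF that(1)] by (simp add: linear_between_def)
  qed (simp_all add: smap_zero[OF M that(1)])
  show "h (nilp_op (shift x M) S f) = nilp_op (shift y M) S (h f)"
  proof
    fix z
    show "h (nilp_op (shift x M) S f) z = nilp_op (shift y M) S (h f) z"
    proof (cases "z \<in> \<Union>(set S)")
      case False
      hence "{i. Suc i < length S \<and> z \<in> S ! Suc i} = {}"
        using nth_mem by fastforce
      hence "nilp_op (shift y M) S (h f) z = 0" unfolding nilp_op_def by (simp only: sum.empty)
      thus ?thesis using False by (simp add: h)
    next
      case True
      have in_S: "u \<in> \<Union>(set S)" if "Suc i < length S" "u \<in> S ! i" for i u
        using that by (meson Suc_lessD UnionI nth_mem)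
      have mon: "x + u \<le> x + z" "y + u \<le> y + z" if "u < z" for u
        using that by (auto simp: less_eq_vec_def less_vec_def)
      let ?t = "\<lambda>u. if u < z then smap M (x + z) (x + u) (f u) else 0"
      have t: "?t u \<in> fibre M (x + z)" if "u \<in> \<Union>(set S)" for u
        using fib[OF that] lin[OF mon(1)] subspace_0[OF sub]
        by (auto simp: linear_between_def image_subset_iff)
      have "smap M (y + z) (x + z) (?t u) =
        (if u < z then smap M (y + z) (y + u) (h f u) else 0)" if "u \<in> \<Union>(set S)" for u
        using that comp[OF mon(1) le fib[OF that]] comp[OF le mon(2) fib[OF that]]
          smap_zero[OF M le]
        by (auto simp: h)
      hence "(\<Sum>i | Suc i < length S \<and> z \<in> S ! Suc i. \<Sum>u\<in>S ! i. smap M (y + z) (x + z) (?t u)) =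
        (\<Sum>i | Suc i < length S \<and> z \<in> S ! Suc i. \<Sum>u\<in>S ! i.
          if u < z then smap M (y + z) (y + u) (h f u) else 0)"
        using in_S by (intro sum.cong refl) blast
      moreover have "smap M (y + z) (x + z)
          (\<Sum>i | Suc i < length S \<and> z \<in> S ! Suc i. \<Sum>u\<in>S ! i. ?t u) =
        (\<Sum>i | Suc i < length S \<and> z \<in> S ! Suc i. \<Sum>u\<in>S ! i. smap M (y + z) (x + z) (?t u))"
        using in_S t sub
        by (subst smap_sum[OF le], blast intro: subspace_sum)
           (intro sum.cong refl smap_sum le, blast)
      ultimately show ?thesis
        using True by (subst h) (simp only: nilp_op_def shift_def pmod.simps if_True)
    qed
  qed
qed

lemma poset_module_jordan_module:
  fixes M :: "('k::field, int^'d::finite, 'a::ab_group_add) pmod"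
  assumes M: "poset_module UNIV M"
  shows "poset_module UNIV (jordan_module i M S)"
proof -
  let ?J = "jordan_module i M S"
  let ?s = "\<lambda>c f z. scalar M c (f z)"
  let ?D = "\<lambda>x. direct_sum (shift x M) S"
  let ?T = "\<lambda>x. nilp_op (shift x M) S"
  interpret V: vector_space "scalar M"
    using M by (simp add: poset_module_def)
  interpret F: vector_space ?s
    by (rule vector_space_pointwise) (rule V.vector_space_axioms)
  have sh: "poset_module UNIV (shift x M)" "scalar (shift x M) = scalar M" for x
    using poset_module_shift[OF M] by (simp_all add: shift_def)
  have J: "scalar ?J = ?s" "fibre ?J x = (?T x ^^ i) ` ?D x" for x
    by (simp_all add: jordan_module_def)
  have T: "linear_between ?s ?s (?D x) (?D x) (?T x ^^ j)" for x j
    using linear_nilp_op[OF sh(1), of x S] sh(2) by (intro linear_between_funpow) simp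
  have D: "F.subspace (?D x)" for x
    using subspace_direct_sum[OF sh(1), of x S] sh(2) by simp
  have sub: "F.subspace (fibre ?J x)" for x
    unfolding J(2) by (rule linear_between_subspace_image[OF F.vector_space_axioms T D])
  have in_D: "f \<in> ?D x" if "f \<in> fibre ?J x" for f x
    using that T[of x i] by (auto simp: J(2) linear_between_def)
  have le: "x + z \<le> y + z" if "x \<le> y" for x y z :: "int^'d"
    using that by (simp add: less_eq_vec_def)
  have fib: "f z \<in> fibre M (x + z)" if "f \<in> fibre ?J x" "z \<in> \<Union>(set S)" for f x z
    using in_D[OF that(1)] that(2) by (auto simp: direct_sum_def shift_def)
  have off: "f z = 0" if "f \<in> fibre ?J x" "z \<notin> \<Union>(set S)" for f x z
    using in_D[OF that(1)] that(2) by (auto simp: direct_sum_def)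
  have h: "smap ?J y x f z = (if z \<in> \<Union>(set S) then smap M (y + z) (x + z) (f z) else 0)" for x y f z
    by (simp add: jordan_module_def)
  have pow: "smap ?J y x ((?T x ^^ j) f) = (?T y ^^ j) (smap ?J y x f)"
    if "x \<le> y" "f \<in> ?D x" for x y f j
  proof (induction j)
    case (Suc j)
    have "(?T x ^^ j) f \<in> ?D x" using T[of x j] that(2) by (auto simp: linear_between_def)
    from jordan_smap_commutes(2)[OF M that(1) this] Suc show ?case by simp
  qed simp
  have maps: "smap ?J y x f \<in> fibre ?J y" if "x \<le> y" "f \<in> fibre ?J x" for x y f
    using that jordan_smap_commutes(1)[OF M that(1)] by (auto simp: J(2) pow)
  have lin: "linear_between (scalar M) (scalar M) (fibre M u) (fibre M v) (smap M v u)"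
    if "u \<le> v" for u v
    using M that by (simp add: poset_module_def)
  have "linear_between (scalar ?J) (scalar ?J) (fibre ?J x) (fibre ?J y) (smap ?J y x)"
    if xy: "x \<le> y" for x y
  proof -
    have "smap ?J y x (f + g) = smap ?J y x f + smap ?J y x g"
      if "f \<in> fibre ?J x" "g \<in> fibre ?J x" for f g
      using lin[OF le[OF xy]] fib[OF that(1)] fib[OF that(2)]
      by (auto simp: fun_eq_iff h linear_between_def)
    moreover have "smap ?J y x (?s c f) = ?s c (smap ?J y x f)" if "f \<in> fibre ?J x" for f c
      using lin[OF le[OF xy]] fib[OF that] by (auto simp: fun_eq_iff h linear_between_def)
    ultimately show ?thesis
      using maps[OF xy] by (auto simp: linear_between_def J(1))
  qed
  moreover have "smap ?J x x f = f" if "f \<in> fibre ?J x" for x f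
    using M fib[OF that] off[OF that] by (auto simp: fun_eq_iff h poset_module_def)
  moreover have "smap ?J w y (smap ?J y x f) = smap ?J w x f"
    if "x \<le> y" "y \<le> w" "f \<in> fibre ?J x" for x y w f
  proof
    fix z
    have "\<forall>v\<in>fibre M (x + z). smap M (w + z) (y + z) (smap M (y + z) (x + z) v) = smap M (w + z) (x + z) v"
      using M le[OF that(1), of z] le[OF that(2), of z] by (simp add: poset_module_def)
    thus "smap ?J w y (smap ?J y x f) z = smap ?J w x f z"
      using fib[OF that(3)] by (simp add: h)
  qed
  ultimately show ?thesis
    using sub F.vector_space_axioms unfolding poset_module_def J(1) by simp
qed

end

theory Submission
  imports Defs
begin

text \<open>
  For the first part, \<open>rk\<^sup>0\<close> at \<open>(x, y)\<close> is the sum of \<open>rk (x + z, y + z)\<close> over \<open>z\<close> in the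
  grid. The summand \<open>z = 0\<close> is \<open>rk (x, y)\<close> itself and all the others start at a point \<open>x + z > x\<close>,
  so \<open>rk\<close> is recovered from \<open>rk\<^sup>0\<close> by downward induction on \<open>x\<^sub>1 + \<dots> + x\<^sub>d\<close>, all ranks being
  finite and vanishing outside the grid.

  For the second part, take modules supported on \<open>p = e\<^sub>a\<close>, \<open>q = e\<^sub>b\<close> and \<open>r = e\<^sub>a + e\<^sub>b\<close>, with a line
  at \<open>p\<close> and at \<open>q\<close>, a plane at \<open>r\<close>, and inclusions as structure maps. The rank invariant only sees
  the two inclusions separately, whereas the image of the nilpotent operator at \<open>0\<close> is the sum of the
  two lines, which has dimension 2 or 1 depending on whether they are distinct.
\<close>

subsection \<open>Ranks on direct sums\<close>

text \<open>Unlike \<open>direct_sum\<close>, this takes an arbitrary family of subsets, so that it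
  also describes images of structure maps, which are not fibres of a given module.\<close>

definition dsum :: "'p set \<Rightarrow> ('p \<Rightarrow> 'a::zero set) \<Rightarrow> ('p \<Rightarrow> 'a) set" where
  "dsum Z W = {f. (\<forall>z\<in>Z. f z \<in> W z) \<and> (\<forall>z. z \<notin> Z \<longrightarrow> f z = 0)}"

lemma direct_sum_eq_dsum: "direct_sum M S = dsum (\<Union>(set S)) (fibre M)"
  by (simp add: direct_sum_def dsum_def)

text \<open>In contrast to \<open>linear_between_subspace_image\<close>, source and target may
  differ, as for a structure map between two fibres.\<close>

lemma subspace_linear_image:
  assumes "vector_space s" and U: "module.subspace s U" and f: "linear_between s s U V f"
  shows "module.subspace s (f ` U)"
proof -
  interpret vector_space s by fact
  have add: "f u + f v = f (u + v)" and scl: "s c (f u) = f (s c u)"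
    if "u \<in> U" "v \<in> U" for u v c
    using f that by (auto simp: linear_between_def)
  have "0 = f 0"
    using scl[of 0 0 0] subspace_0[OF U] by simp
  thus ?thesis
    using U by (intro subspaceI)
      (auto simp: add scl subspace_add subspace_scale subspace_0 intro!: image_eqI)
qed

lemma fin_dim_linear_image:
  assumes vs: "vector_space s" and U: "module.subspace s U" and fin: "fin_dim s U"
    and f: "linear_between s s U V f"
  shows "fin_dim s (f ` U)"
proof -
  interpret vector_space s by fact
  obtain B where B: "finite B" "span B = U"
    using fin by (auto simp: fin_dim_def)
  have BU: "B \<subseteq> U" using B span_superset by blast
  have f0: "f 0 = 0"
  proof -
    have "f (s 0 0) = s 0 (f 0)"
      using f subspace_0[OF U] unfolding linear_between_def by blast
    thus ?thesis by simp
  qed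
  have "subspace {u \<in> U. f u \<in> span (f ` B)}"
    using f U unfolding linear_between_def
    by (intro subspaceI)
      (auto simp: subspace_0 subspace_add subspace_scale f0 span_zero span_add span_scale)
  moreover have "B \<subseteq> {u \<in> U. f u \<in> span (f ` B)}"
    using BU by (auto intro: span_base)
  ultimately have "U \<subseteq> {u \<in> U. f u \<in> span (f ` B)}"
    using span_minimal B(2) by blast
  moreover have "span (f ` B) \<subseteq> f ` U"
    using BU by (intro span_minimal subspace_linear_image[OF vs U f]) auto
  ultimately have "span (f ` B) = f ` U" by blast
  thus ?thesis using B(1) by (auto simp: fin_dim_def)
qed

lemma sum_fun_apply: "(\<Sum>i\<in>I. f i) x = (\<Sum>i\<in>I. f i x)"
  for f :: "'i \<Rightarrow> 'p \<Rightarrow> 'a::comm_monoid_add"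
  by (induction I rule: infinite_finite_induct) simp_all

lemma enat_sum: "enat (\<Sum>i\<in>I. f i) = (\<Sum>i\<in>I. enat (f i))"
  by (simp flip: of_nat_eq_enat)

text \<open>Bases of the \<open>W z\<close>, each placed at its own coordinate, together form a
  basis of the direct sum.\<close>

lemma dim_dsum:
  fixes s :: "'k::field \<Rightarrow> 'a::ab_group_add \<Rightarrow> 'a" and Z :: "'p set"
  assumes vs: "vector_space s" and Z: "finite Z"
    and W: "\<And>z. z \<in> Z \<Longrightarrow> module.subspace s (W z)"
    and fin: "\<And>z. z \<in> Z \<Longrightarrow> fin_dim s (W z)"
  defines "t \<equiv> \<lambda>c (f :: 'p \<Rightarrow> 'a) z. s c (f z)"
  shows "fin_dim t (dsum Z W)"
    and "vector_space.dim t (dsum Z W) = (\<Sum>z\<in>Z. vector_space.dim s (W z))"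
proof -
  interpret vector_space s by fact
  interpret F: vector_space t
    unfolding t_def by (rule vector_space_pointwise[OF vs])
  let ?e = "\<lambda>z v. (\<lambda>_. 0 :: 'a)(z := v)"
  have "\<exists>B. finite B \<and> independent B \<and> span B = W z \<and> card B = dim (W z)" if z: "z \<in> Z" for z
  proof -
    obtain C where C: "finite C" "span C = W z" using fin[OF z] by (auto simp: fin_dim_def)
    obtain B where B: "B \<subseteq> W z" "independent B" "W z \<subseteq> span B" "card B = dim (W z)"
      using basis_exists by blast
    have "finite B" using independent_span_bound[OF C(1) B(2)] B(1) C(2) by blast
    moreover have "span B = W z" using B span_minimal[OF B(1) W[OF z]] by blast
    ultimately show ?thesis using B by blast
  qed
  then obtain B where B: "\<And>z. z \<in> Z \<Longrightarrow> finite (B z)" "\<And>z. z \<in> Z \<Longrightarrow> independent (B z)"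
    "\<And>z. z \<in> Z \<Longrightarrow> span (B z) = W z" "\<And>z. z \<in> Z \<Longrightarrow> card (B z) = dim (W z)"
    by metis
  define BB where "BB = (\<lambda>(z, b). ?e z b) ` Sigma Z B"
  \<comment> \<open>A nonzero vector reveals the coordinate at which it sits. This makes the placed
    basis vectors pairwise distinct, so that cardinalities add up.\<close>
  have nz: "b \<noteq> 0" if "z \<in> Z" "b \<in> B z" for z b
    using B(2)[OF that(1)] that(2) dependent_zero by blast
  have inj: "inj_on (\<lambda>(z, b). ?e z b) (Sigma Z B)"
  proof (rule inj_onI, clarify)
    fix z b z' b'
    assume A: "z \<in> Z" "b \<in> B z" "z' \<in> Z" "b' \<in> B z'" and eq: "?e z b = ?e z' b'"
    have "?e z' b' z = b" using fun_cong[OF eq, of z] by simp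
    hence "z = z'" using nz[OF A(1,2)] by (auto split: if_splits)
    thus "z = z' \<and> b = b'" using fun_cong[OF eq, of z] by simp
  qed
  have finBB: "finite BB" unfolding BB_def using Z B(1) by auto
  have indep: "F.independent BB"
  proof (rule F.independent_if_scalars_zero[OF finBB])
    fix u g assume sum0: "(\<Sum>g\<in>BB. t (u g) g) = 0" and "g \<in> BB"
    then obtain z b where zb: "z \<in> Z" "b \<in> B z" "g = ?e z b" by (auto simp: BB_def)
    have "(\<Sum>g\<in>BB. t (u g) g) = (\<Sum>(w, c)\<in>Sigma Z B. t (u (?e w c)) (?e w c))"
      unfolding BB_def by (subst sum.reindex[OF inj]) (simp add: case_prod_unfold)
    also have "\<dots> = (\<Sum>w\<in>Z. \<Sum>c\<in>B w. t (u (?e w c)) (?e w c))"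
      using Z B(1) by (subst sum.Sigma) auto
    \<comment> \<open>Evaluation at \<open>z\<close> kills the basis vectors placed elsewhere and
      leaves a linear relation among those of \<open>W z\<close>.\<close>
    finally have "0 = (\<Sum>w\<in>Z. \<Sum>c\<in>B w. t (u (?e w c)) (?e w c)) z"
      using sum0 by simp
    also have "\<dots> = (\<Sum>w\<in>Z. \<Sum>c\<in>B w. t (u (?e w c)) (?e w c) z)"
      by (simp add: sum_fun_apply)
    also have "\<dots> = (\<Sum>w\<in>Z. if w = z then \<Sum>c\<in>B z. s (u (?e z c)) c else 0)"
      by (intro sum.cong refl) (auto simp: t_def)
    also have "\<dots> = (\<Sum>c\<in>B z. s (u (?e z c)) c)"
      using Z zb(1) by simp
    finally show "u g = 0"
      using independentD[OF B(2)[OF zb(1)] B(1)[OF zb(1)] subset_refl, of "\<lambda>c. u (?e z c)" b] zb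
      by simp
  qed
  have "F.subspace (dsum Z W)"
    using W by (intro F.subspaceI)
      (auto simp: dsum_def t_def subspace_0 subspace_add subspace_scale)
  moreover have "BB \<subseteq> dsum Z W"
    using B(3) W span_base by (fastforce simp: BB_def dsum_def intro: subspace_0)
  moreover have "dsum Z W \<subseteq> F.span BB"
  proof
    fix f assume f: "f \<in> dsum Z W"
    have "?e z v \<in> F.span BB" if z: "z \<in> Z" and v: "v \<in> W z" for z v
    proof -
      have add: "?e z (v + w) = ?e z v + ?e z w" and scl: "?e z (s c v) = t c (?e z v)"
        and zero: "?e z 0 = 0" for v w c
        by (auto simp: fun_eq_iff t_def)
      \<comment> \<open>Placing a vector at \<open>z\<close> is linear, so it is enough to treat the
        generators \<open>B z\<close>.\<close>
      have "subspace {v. ?e z v \<in> F.span BB}"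
        by (intro subspaceI) (auto simp only: mem_Collect_eq add scl zero
            intro: F.span_zero F.span_add F.span_scale)
      moreover have "B z \<subseteq> {v. ?e z v \<in> F.span BB}"
        using z by (auto simp: BB_def intro!: F.span_base)
      ultimately have "span (B z) \<subseteq> {v. ?e z v \<in> F.span BB}"
        by (intro span_minimal)
      thus ?thesis using v B(3)[OF z] by blast
    qed
    hence "(\<Sum>z\<in>Z. ?e z (f z)) \<in> F.span BB"
      using f by (intro F.span_sum) (auto simp: dsum_def)
    moreover have "(\<Sum>z\<in>Z. ?e z (f z)) = f"
    proof
      fix w
      have "(\<Sum>z\<in>Z. ?e z (f z)) w = (\<Sum>z\<in>Z. if z = w then f w else 0)"
        unfolding sum_fun_apply by (intro sum.cong refl) auto
      thus "(\<Sum>z\<in>Z. ?e z (f z)) w = f w"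
        using f Z by (auto simp: dsum_def)
    qed
    ultimately show "f \<in> F.span BB" by simp
  qed
  ultimately have span: "F.span BB = dsum Z W"
    using F.span_minimal by blast
  show "fin_dim t (dsum Z W)"
    using span finBB by (auto simp: fin_dim_def)
  have "F.dim (dsum Z W) = card BB"
    using F.dim_span_eq_card_independent[OF indep] span by simp
  also have "\<dots> = (\<Sum>z\<in>Z. dim (W z))"
    unfolding BB_def using B(1,4) Z by (subst card_image[OF inj]) simp
  finally show "F.dim (dsum Z W) = (\<Sum>z\<in>Z. dim (W z))" .
qed

subsection \<open>The classical rank invariant and the zeroth Jordan rank\<close>

lemma Union_grid_layers:
  fixes l :: "int^'d::finite"
  assumes "0 \<le> l"
  shows "\<Union>(set (grid_layers l)) = {0..l}"
proof (intro equalityI subsetI)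
  fix x assume x: "x \<in> {0..l}"
  have "0 \<le> (\<Sum>j\<in>UNIV. x $ j)" "(\<Sum>j\<in>UNIV. x $ j) \<le> (\<Sum>j\<in>UNIV. l $ j)"
    using x by (auto simp: less_eq_vec_def intro!: sum_nonneg sum_mono)
  \<comment> \<open>Layers are numbered from 1, and layer \<open>i\<close> holds the points with
    coordinate sum \<open>i - 1\<close>; hence the shift by one.\<close>
  hence "nat (\<Sum>j\<in>UNIV. x $ j) + 1 \<in> set [1..<nat (\<Sum>j\<in>UNIV. l $ j) + 1 + 1]"
    "(\<Sum>j\<in>UNIV. x $ j) = int (nat (\<Sum>j\<in>UNIV. x $ j) + 1) - 1"
    by auto
  thus "x \<in> \<Union>(set (grid_layers l))"
    using x unfolding grid_layers_def Let_def set_map by blast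
qed (auto simp: grid_layers_def Let_def)

text \<open>A box is covered by the image of a finite product of integer intervals, one for each
  coordinate.\<close>

lemma finite_grid: "finite {0..l :: int^'d::finite}"
proof -
  have "vec_lambda ` (Pi UNIV (\<lambda>j. {0..l $ j})) \<supseteq> {0..l}"
  proof
    fix x assume "x \<in> {0..l}"
    hence "x = vec_lambda (vec_nth x)" "vec_nth x \<in> Pi UNIV (\<lambda>j. {0..l $ j})"
      by (auto simp: less_eq_vec_def)
    thus "x \<in> vec_lambda ` (Pi UNIV (\<lambda>j. {0..l $ j}))" by blast
  qed
  moreover have "finite (Pi UNIV (\<lambda>j. {0..l $ j}))"
    using finite_PiE[of UNIV "\<lambda>j. {0..l $ j}"] by (simp add: PiE_UNIV_domain)
  ultimately show ?thesis by (meson finite_imageI finite_subset)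
qed

text \<open>The power 0 of the operator is the identity, so the fibre is the full direct sum. The
  transition map acts coordinatewise, its image is the direct sum of the images, and dimensions add
  up.\<close>

lemma jordan_rank_0:
  fixes M :: "('k::field, int^'d::finite, 'a::ab_group_add) pmod"
  assumes M: "poset_module UNIV M" and fin: "pointwise_fin_dim UNIV M"
    and S: "finite (\<Union>(set S))" and xy: "x \<le> y"
  shows "jordan_rank 0 M S x y = (\<Sum>z\<in>\<Union>(set S). rank_invariant M (x + z) (y + z))"
proof -
  let ?s = "scalar M" and ?Z = "\<Union>(set S)"
  let ?W = "\<lambda>z. smap M (y + z) (x + z) ` fibre M (x + z)"
  have vs: "vector_space ?s" using M by (simp add: poset_module_def)
  have le: "x + z \<le> y + z" for z using xy by (simp add: less_eq_vec_def)
  have sub: "module.subspace ?s (fibre M z)" for z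
    using M by (simp add: poset_module_def)
  have lin: "linear_between ?s ?s (fibre M (x + z)) (fibre M (y + z)) (smap M (y + z) (x + z))" for z
    using M le by (simp add: poset_module_def)
  have W: "module.subspace ?s (?W z)" for z
    by (rule subspace_linear_image[OF vs sub lin])
  have fW: "fin_dim ?s (?W z)" for z
    using fin by (intro fin_dim_linear_image[OF vs sub _ lin]) (simp add: pointwise_fin_dim_def)
  let ?J = "jordan_module 0 M S"
  have "smap ?J y x ` fibre ?J x = dsum ?Z ?W"
  proof (intro equalityI subsetI)
    fix g assume g: "g \<in> dsum ?Z ?W"
    \<comment> \<open>Preimages are chosen separately at each coordinate and continued by zero off
      \<open>?Z\<close>.\<close>
    hence "\<forall>z\<in>?Z. \<exists>v. v \<in> fibre M (x + z) \<and> g z = smap M (y + z) (x + z) v"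
      unfolding dsum_def by blast
    then obtain f where f: "\<And>z. z \<in> ?Z \<Longrightarrow> f z \<in> fibre M (x + z) \<and> g z = smap M (y + z) (x + z) (f z)"
      by metis
    let ?f = "\<lambda>z. if z \<in> ?Z then f z else 0"
    have "?f \<in> fibre ?J x"
      using f by (auto simp: jordan_module_def direct_sum_eq_dsum dsum_def shift_def)
    moreover have "smap ?J y x ?f = g"
      using f g by (auto simp: fun_eq_iff jordan_module_def dsum_def)
    ultimately show "g \<in> smap ?J y x ` fibre ?J x" by blast
  qed (auto simp: jordan_module_def direct_sum_eq_dsum dsum_def shift_def)
  moreover have "scalar ?J = (\<lambda>c f z. ?s c (f z))" by (simp add: jordan_module_def)
  ultimately have "jordan_rank 0 M S x y = enat (\<Sum>z\<in>?Z. vector_space.dim ?s (?W z))"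
    using dim_dsum[OF vs S W fW] xy
    by (simp add: jordan_rank_def rank_invariant_def rank_on_def)
  also have "\<dots> = (\<Sum>z\<in>?Z. rank_invariant M (x + z) (y + z))"
    using le fW by (simp add: rank_invariant_def rank_on_def enat_sum)
  finally show ?thesis .
qed

lemma pointwise_fin_dim_zero_extension:
  assumes "poset_module P M" "pointwise_fin_dim P M"
  shows "pointwise_fin_dim UNIV (zero_extension P M)"
proof -
  interpret vector_space "scalar M" using assms(1) by (simp add: poset_module_def)
  have "fin_dim (scalar M) {0}"
    unfolding fin_dim_def by (rule exI[of _ "{}"]) simp
  thus ?thesis using assms(2) by (simp add: pointwise_fin_dim_def zero_extension_def)
qed

lemma rank_invariant_finite:
  assumes M: "poset_module UNIV M" and fin: "pointwise_fin_dim UNIV M" and "x \<le> y"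
  shows "rank_invariant M x y \<noteq> \<infinity>"
proof -
  have "fin_dim (scalar M) (smap M y x ` fibre M x)"
    using M fin assms(3)
    by (intro fin_dim_linear_image[where U = "fibre M x" and V = "fibre M y"])
      (auto simp: poset_module_def pointwise_fin_dim_def)
  thus ?thesis by (simp add: rank_invariant_def rank_on_def assms(3))
qed

lemma rank_on_eq_0:
  assumes "vector_space s" and "f ` U = {0}"
  shows "rank_on s U f = 0"
proof -
  interpret vector_space s by fact
  have "span {} = {0}" by simp
  hence "fin_dim s {0}" unfolding fin_dim_def by blast
  moreover have "dim {0} = 0" using dim_span[of "{}"] dim_eq_card_independent[of "{}"]
    by (simp add: independent_empty)
  ultimately show ?thesis using assms(2) by (simp add: rank_on_def enat_0)
qed

text \<open>The extended structure map is zero once either end leaves \<open>P\<close>. For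
  \<open>x\<close> outside the grid this is where the downward induction on \<open>x\<close>
  stops.\<close>

lemma rank_invariant_zero_extension_outside:
  assumes "poset_module P M" and "x \<notin> P \<or> y \<notin> P" and "x \<le> y"
  shows "rank_invariant (zero_extension P M) x y = 0"
proof -
  have vs: "vector_space (scalar M)" using assms(1) by (simp add: poset_module_def)
  interpret vector_space "scalar M" by (rule vs)
  have "0 \<in> fibre (zero_extension P M) x"
    using assms(1) by (auto simp: zero_extension_def poset_module_def intro: subspace_0)
  hence "smap (zero_extension P M) y x ` fibre (zero_extension P M) x = {0}"
    using assms(2) by (auto simp: zero_extension_def)
  hence "rank_on (scalar M) (fibre (zero_extension P M) x) (smap (zero_extension P M) y x) = 0"
    by (rule rank_on_eq_0[OF vs])
  moreover have "scalar (zero_extension P M) = scalar M" by (simp add: zero_extension_def)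
  ultimately show ?thesis
    using assms(3) by (simp add: rank_invariant_def)
qed

text \<open>By \<open>jordan_rank_0\<close>, one invariant is obtained from the other by a
  triangular system with coefficient 1 on the diagonal \<open>z = 0\<close>, which can be solved
  from the top of the grid downwards.\<close>

lemma jordan_rank_0_eq_iff:
  fixes l :: "int^'d::finite"
    and M :: "('k::field, int^'d, 'a::ab_group_add) pmod"
    and N :: "('k, int^'d, 'b::ab_group_add) pmod"
  assumes l: "0 \<le> l"
    and M: "poset_module {0..l} M" "pointwise_fin_dim {0..l} M"
    and N: "poset_module {0..l} N" "pointwise_fin_dim {0..l} N"
  shows "jordan_rank 0 (zero_extension {0..l} M) (grid_layers l) =
      jordan_rank 0 (zero_extension {0..l} N) (grid_layers l) \<longleftrightarrow>
    rank_invariant (zero_extension {0..l} M) = rank_invariant (zero_extension {0..l} N)"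
proof -
  let ?M = "zero_extension {0..l} M" and ?N = "zero_extension {0..l} N"
  note Z = Union_grid_layers[OF l]
  have M': "poset_module UNIV ?M" "pointwise_fin_dim UNIV ?M"
    using poset_module_zero_extension[OF M(1) grid_convex]
      pointwise_fin_dim_zero_extension[OF M] by auto
  have N': "poset_module UNIV ?N" "pointwise_fin_dim UNIV ?N"
    using poset_module_zero_extension[OF N(1) grid_convex]
      pointwise_fin_dim_zero_extension[OF N] by auto
  have sum_M: "jordan_rank 0 ?M (grid_layers l) x y = (\<Sum>z\<in>{0..l}. rank_invariant ?M (x + z) (y + z))"
    and sum_N: "jordan_rank 0 ?N (grid_layers l) x y = (\<Sum>z\<in>{0..l}. rank_invariant ?N (x + z) (y + z))"
    if "x \<le> y" for x y
    using jordan_rank_0[OF M', of "grid_layers l" x y] jordan_rank_0[OF N', of "grid_layers l" x y]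
      that finite_grid[of l] by (simp_all add: Z)
  show ?thesis
  proof
    assume eq: "rank_invariant ?M = rank_invariant ?N"
    show "jordan_rank 0 ?M (grid_layers l) = jordan_rank 0 ?N (grid_layers l)"
    proof (intro ext)
      fix x y
      show "jordan_rank 0 ?M (grid_layers l) x y = jordan_rank 0 ?N (grid_layers l) x y"
      proof (cases "x \<le> y")
        case True
        thus ?thesis by (simp add: sum_M sum_N eq)
      qed (simp add: jordan_rank_def rank_invariant_def)
    qed
  next
    assume eq: "jordan_rank 0 ?M (grid_layers l) = jordan_rank 0 ?N (grid_layers l)"
    have "rank_invariant ?M x y = rank_invariant ?N x y" if "x \<le> y" for x y
      using that
    \<comment> \<open>The summand 1 guards against truncation by \<open>nat\<close>: the measure
      must still drop when \<open>x = l\<close> and the translate leaves the grid. Since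
      \<open>x\<close> and \<open>y\<close> are translated together, \<open>y\<close> is generalised
      too.\<close>
    proof (induction "nat (1 + (\<Sum>j\<in>UNIV. l $ j - x $ j))" arbitrary: x y rule: less_induct)
      case less
      show ?case
      proof (cases "x \<in> {0..l}")
        case False
        thus ?thesis using less.prems
          by (simp add: rank_invariant_zero_extension_outside[OF M(1)]
              rank_invariant_zero_extension_outside[OF N(1)])
      next
        case True
        have le: "x + z \<le> y + z" for z using less.prems by (simp add: less_eq_vec_def)
        have *: "rank_invariant ?M (x + z) (y + z) = rank_invariant ?N (x + z) (y + z)"
          if z: "z \<in> {0..l} - {0}" for z
        proof (rule less.hyps[OF _ le])
          have z0: "\<And>j. 0 \<le> z $ j" using z by (simp add: less_eq_vec_def)
          obtain i where "z $ i \<noteq> 0" using z by (auto simp: vec_eq_iff)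
          hence "0 < z $ i" using z0[of i] by simp
          hence "(\<Sum>j\<in>UNIV. l $ j - (x + z) $ j) < (\<Sum>j\<in>UNIV. l $ j - x $ j)"
            using z0 by (intro sum_strict_mono_ex1) auto
          moreover have "0 \<le> (\<Sum>j\<in>UNIV. l $ j - x $ j)"
            using True by (intro sum_nonneg) (simp add: less_eq_vec_def)
          ultimately show "nat (1 + (\<Sum>j\<in>UNIV. l $ j - (x + z) $ j)) < nat (1 + (\<Sum>j\<in>UNIV. l $ j - x $ j))"
            by linarith
        qed
        \<comment> \<open>The term at \<open>z = 0\<close> is the unknown rank at
          \<open>(x, y)\<close>; the remaining ones are covered by the induction hypothesis.\<close>
        have split: "(\<Sum>z\<in>{0..l}. f z) = f 0 + (\<Sum>z\<in>{0..l} - {0}. f z)" for f :: "_ \<Rightarrow> enat"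
          using l finite_grid[of l] by (intro sum.remove) auto
        let ?r = "\<Sum>z\<in>{0..l} - {0}. rank_invariant ?N (x + z) (y + z)"
        have "rank_invariant ?M x y + ?r = rank_invariant ?N x y + ?r"
          using fun_cong[OF fun_cong[OF eq, of x], of y] *
          by (simp add: sum_M[OF less.prems] sum_N[OF less.prems] split)
        \<comment> \<open>In \<open>enat\<close> a common summand can be cancelled only if it is
          finite.\<close>
        moreover have "?r \<noteq> \<infinity>"
        proof -
          have "\<exists>n. rank_invariant ?N (x + z) (y + z) = enat n" for z
            using rank_invariant_finite[OF N' le] by (simp add: not_infinity_eq)
          then obtain n where "\<And>z. rank_invariant ?N (x + z) (y + z) = enat (n z)"
            by metis
          thus ?thesis by (simp flip: enat_sum)
        qed
        ultimately show ?thesis by simp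
      qed
    qed
    moreover have "rank_invariant ?M x y = rank_invariant ?N x y" if "\<not> x \<le> y" for x y
      using that by (simp add: rank_invariant_def)
    ultimately show "rank_invariant ?M = rank_invariant ?N" by blast
  qed
qed

subsection \<open>Modules of inclusions supported on a corner\<close>

text \<open>The map is the identity whenever the target lies in \<open>C\<close>. A source outside
  \<open>C\<close> has the fibre zero, so there this is still the zero map.\<close>

definition inclusion_module ::
    "('k \<Rightarrow> 'a \<Rightarrow> 'a) \<Rightarrow> 'p set \<Rightarrow> ('p \<Rightarrow> 'a set) \<Rightarrow> ('k, 'p, 'a::zero) pmod" where
  "inclusion_module s C W =
     \<lparr>scalar = s,
      fibre = (\<lambda>x. if x \<in> C then W x else {0}),
      smap = (\<lambda>y x v. if y \<in> C then v else 0)\<rparr>"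

text \<open>Convexity gives functoriality: a chain from \<open>C\<close> to \<open>C\<close> through
  a point outside would factor an inclusion through zero.\<close>

lemma poset_module_inclusion_module:
  assumes vs: "vector_space s"
    and W: "\<And>x. x \<in> C \<Longrightarrow> module.subspace s (W x)"
    and mono: "\<And>x y. x \<in> C \<Longrightarrow> y \<in> C \<Longrightarrow> x \<le> y \<Longrightarrow> W x \<subseteq> W y"
    and convex: "\<And>x y z. x \<in> C \<Longrightarrow> z \<in> C \<Longrightarrow> x \<le> y \<Longrightarrow> y \<le> z \<Longrightarrow> y \<in> C"
  shows "poset_module P (inclusion_module s C W)"
proof -
  interpret vector_space s by fact
  have lin: "linear_between s s (if x \<in> C then W x else {0}) (if y \<in> C then W y else {0})
      (\<lambda>v. if y \<in> C then v else 0)" if "x \<le> y" for x y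
    using mono[of x y] that W[of y] subspace_0 by (auto simp: linear_between_def)
  have sub: "subspace (if x \<in> C then W x else {0})" for x
    using W by simp
  have ident: "(if x \<in> C then v else 0) = v" if "v \<in> (if x \<in> C then W x else {0})" for x v
    using that by (auto split: if_splits)
  have comp: "(if z \<in> C then if y \<in> C then v else 0 else 0) = (if z \<in> C then v else 0)"
    if "x \<le> y" "y \<le> z" "v \<in> (if x \<in> C then W x else {0})" for x y z v
    using that convex[of x z y] by (auto split: if_splits)
  show ?thesis
    unfolding poset_module_def inclusion_module_def pmod.simps
    by (intro conjI ballI allI impI; rule vs sub lin ident comp; assumption)
qed

lemma rank_invariant_inclusion_module:
  assumes vs: "vector_space s" and CP: "C \<subseteq> P"
    and W: "\<And>x. x \<in> C \<Longrightarrow> module.subspace s (W x)"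
  shows "rank_invariant (zero_extension P (inclusion_module s C W)) x y =
    (if x \<le> y then if x \<in> C \<and> y \<in> C then rank_on s (W x) (\<lambda>v. v) else 0 else \<infinity>)"
proof -
  interpret vector_space s by fact
  let ?E = "zero_extension P (inclusion_module s C W)"
  have sc: "scalar ?E = s" by (simp add: zero_extension_def inclusion_module_def)
  show ?thesis
  proof (cases "x \<in> C \<and> y \<in> C")
    case True
    hence "x \<in> P" "y \<in> P" using CP by auto
    hence "fibre ?E x = W x" "smap ?E y x = (\<lambda>v. v)"
      using True by (simp_all add: zero_extension_def inclusion_module_def)
    thus ?thesis using True by (simp add: rank_invariant_def sc)
  next
    case False
    have "0 \<in> fibre ?E x"
      using W subspace_0 by (simp add: zero_extension_def inclusion_module_def)
    hence "smap ?E y x ` fibre ?E x = {0}"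
      using False by (auto simp: zero_extension_def inclusion_module_def image_iff split: if_splits)
    thus ?thesis using False rank_on_eq_0[OF vs] by (auto simp: rank_invariant_def sc)
  qed
qed

section \<open>The nilpotent operator on the layers of the grid\<close>

lemma nth_grid_layers:
  assumes "i < length (grid_layers l)"
  shows "grid_layers l ! i = {x \<in> {0..l}. (\<Sum>j\<in>UNIV. x $ j) = int i}"
  using assms by (simp add: grid_layers_def Let_def del: upt_Suc)

text \<open>The layers are the level sets of the coordinate sum, so the outer sum of
  \<open>nilp_op\<close> has at most one index, determined by \<open>y\<close>.\<close>

lemma nilp_op_grid_layers:
  fixes l :: "int^'d::finite"
  assumes "y \<in> {0..l}"
  shows "nilp_op M (grid_layers l) f y =
    (\<Sum>x | x \<in> {0..l} \<and> (\<Sum>j\<in>UNIV. x $ j) + 1 = (\<Sum>j\<in>UNIV. y $ j).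
       if x < y then smap M y x (f x) else 0)"
proof -
  let ?sz = "\<lambda>x :: int^'d. \<Sum>j\<in>UNIV. x $ j"
  have sz0: "0 \<le> ?sz x" if "x \<in> {0..l}" for x
    using that by (auto simp: less_eq_vec_def intro!: sum_nonneg)
  have szl: "?sz y \<le> ?sz l"
    using assms by (auto simp: less_eq_vec_def intro!: sum_mono)
  have len: "length (grid_layers l) = nat (?sz l) + 1"
    by (simp add: grid_layers_def Let_def)
  have I: "{i. Suc i < length (grid_layers l) \<and> y \<in> grid_layers l ! Suc i} =
      {i. int i + 1 = ?sz y}"
    using assms szl by (auto simp: nth_grid_layers len)
  show ?thesis
  proof (cases "?sz y = 0")
    \<comment> \<open>At the origin both sums are empty: no layer precedes the first, and no grid
      point has a negative coordinate sum.\<close>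
    case True
    hence "{i. int i + 1 = ?sz y} = {}" "{x. x \<in> {0..l} \<and> ?sz x + 1 = ?sz y} = {}"
      using sz0 by force+
    thus ?thesis unfolding nilp_op_def I by (simp only: sum.empty)
  next
    case False
    \<comment> \<open>List positions start at 0, so position \<open>n\<close> holds the points of
      coordinate sum \<open>n\<close>, and \<open>y\<close> lies at position
      \<open>Suc n\<close>.\<close>
    define n where "n = nat (?sz y - 1)"
    have n: "int n + 1 = ?sz y" using False sz0[OF assms] by (simp add: n_def)
    hence "{i. int i + 1 = ?sz y} = {n}" by auto
    moreover have "grid_layers l ! n = {x. x \<in> {0..l} \<and> ?sz x + 1 = ?sz y}"
      using n szl by (subst nth_grid_layers) (auto simp: len)
    ultimately show ?thesis unfolding nilp_op_def I by simp
  qed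
qed

lemma nilp_op_outside:
  assumes "y \<notin> \<Union>(set S)"
  shows "nilp_op M S f y = 0"
proof -
  have "{i. Suc i < length S \<and> y \<in> S ! Suc i} = {}"
    using assms nth_mem by fastforce
  thus ?thesis unfolding nilp_op_def by (simp only: sum.empty)
qed

section \<open>The corner spanned by two coordinate axes\<close>

locale corner =
  fixes a b :: "'d::finite" and l :: "int^'d"
  assumes ab: "a \<noteq> b" and l: "\<forall>j. 1 \<le> l $ j"
begin

definition p :: "int^'d" where "p = axis a 1"
definition q :: "int^'d" where "q = axis b 1"
definition r :: "int^'d" where "r = p + q"

lemma nth_corner:
  "p $ j = (if j = a then 1 else 0)"
  "q $ j = (if j = b then 1 else 0)"
  "r $ j = (if j = a \<or> j = b then 1 else 0)"
  using ab by (auto simp: p_def q_def r_def axis_def)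

lemma distinct_corner: "p \<noteq> q" "p \<noteq> r" "q \<noteq> r"
  using ab by (auto simp: vec_eq_iff nth_corner split: if_splits)

lemma corner_le: "p \<le> r" "q \<le> r" "\<not> p \<le> q" "\<not> q \<le> p" "\<not> r \<le> p" "\<not> r \<le> q"
  using ab by (auto simp: less_eq_vec_def nth_corner split: if_splits)

text \<open>The point \<open>r\<close> exceeds \<open>p\<close> in the single coordinate
  \<open>b\<close>, and by 1. An integer point between them is therefore one of the two; likewise
  for \<open>q\<close>, with the coordinate \<open>a\<close>.\<close>

lemma corner_convex:
  assumes "x \<in> {p, q, r}" "z \<in> {p, q, r}" "x \<le> y" "y \<le> z"
  shows "y \<in> {p, q, r}"
proof -
  have between: "y = p \<or> y = r" if "p \<le> y" "y \<le> r" for y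
  proof -
    have A: "p $ j \<le> y $ j" "y $ j \<le> r $ j" for j
      using that by (auto simp: less_eq_vec_def)
    have "y $ b = 0 \<or> y $ b = 1"
      using A[of b] ab by (auto simp: nth_corner)
    then obtain c where c: "y $ b = c" "c = 0 \<or> c = 1" by blast
    have "y $ j = (if j = b then c else p $ j)" for j
      using A[of j] c(1) by (auto simp: nth_corner split: if_splits)
    thus ?thesis using ab c(2) by (auto simp: vec_eq_iff nth_corner)
  qed
  have between': "y = q \<or> y = r" if "q \<le> y" "y \<le> r" for y
  proof -
    have A: "q $ j \<le> y $ j" "y $ j \<le> r $ j" for j
      using that by (auto simp: less_eq_vec_def)
    have "y $ a = 0 \<or> y $ a = 1"
      using A[of a] ab by (auto simp: nth_corner)
    then obtain c where c: "y $ a = c" "c = 0 \<or> c = 1" by blast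
    have "y $ j = (if j = a then c else q $ j)" for j
      using A[of j] c(1) by (auto simp: nth_corner split: if_splits)
    thus ?thesis using ab c(2) by (auto simp: vec_eq_iff nth_corner)
  qed
  have "x \<le> z" using assms(3,4) by (rule order_trans)
  hence "x = z \<or> x = p \<and> z = r \<or> x = q \<and> z = r"
    using assms(1,2) corner_le by auto
  thus ?thesis
    using assms between[of y] between'[of y] by auto
qed

lemma corner_in_grid: "{p, q, r} \<subseteq> {0..l}"
  using l by (auto simp: less_eq_vec_def nth_corner order_trans[OF zero_le_one])

lemma size_corner: "(\<Sum>j\<in>UNIV. p $ j) = 1" "(\<Sum>j\<in>UNIV. q $ j) = 1" "(\<Sum>j\<in>UNIV. r $ j) = 2"
proof -
  show A: "(\<Sum>j\<in>UNIV. p $ j) = 1" "(\<Sum>j\<in>UNIV. q $ j) = 1" by (simp_all add: nth_corner)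
  show "(\<Sum>j\<in>UNIV. r $ j) = 2" using A by (simp add: r_def sum.distrib)
qed

text \<open>Giving generators instead of fibres makes the fibres subspaces automatically, and
  finite-dimensional as soon as the sets \<open>G x\<close> are finite.\<close>

definition corner_module ::
    "('k::field \<Rightarrow> 'a \<Rightarrow> 'a) \<Rightarrow> (int^'d \<Rightarrow> 'a set) \<Rightarrow> ('k, int^'d, 'a::ab_group_add) pmod" where
  "corner_module s G = inclusion_module s {p, q, r} (\<lambda>x. module.span s (G x))"

text \<open>The only strict relations in the corner are \<open>p < r\<close> and
  \<open>q < r\<close>, so the inclusion of generators yields all monotonicity required.\<close>

lemma poset_module_corner_module:
  assumes vs: "vector_space s" and "G p \<union> G q \<subseteq> G r"
  shows "poset_module P (corner_module s G)"
proof -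
  interpret vector_space s by fact
  have mono: "span (G x) \<subseteq> span (G y)" if "x \<in> {p, q, r}" "y \<in> {p, q, r}" "x \<le> y" for x y
    using that corner_le assms(2) by (intro span_mono) auto
  show ?thesis
    unfolding corner_module_def
    by (rule poset_module_inclusion_module[OF vs])
      (rule subspace_span | erule (2) mono | erule (3) corner_convex)+
qed

lemma pointwise_fin_dim_corner_module:
  assumes vs: "vector_space s" and fin: "\<And>x. finite (G x)"
  shows "pointwise_fin_dim P (corner_module s G)"
proof -
  interpret vector_space s by fact
  have "span {} = {0}" by simp
  thus ?thesis
    using fin unfolding pointwise_fin_dim_def fin_dim_def corner_module_def inclusion_module_def
    by (auto simp del: span_empty)
qed

text \<open>Inclusions are injective, so a rank within the corner depends on the dimension at the
  source alone. The relative position of the subspaces is invisible to it.\<close>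

lemma rank_invariant_corner_module:
  assumes vs: "vector_space s" and fin: "\<And>x. finite (G x)"
  shows "rank_invariant (zero_extension {0..l} (corner_module s G)) x y =
    (if x \<le> y then
       if x \<in> {p, q, r} \<and> y \<in> {p, q, r} then enat (vector_space.dim s (G x)) else 0
     else \<infinity>)"
proof -
  interpret vector_space s by fact
  have "rank_on s (span (G x)) (\<lambda>v. v) = enat (dim (G x))" for x
    using fin[of x] by (auto simp: rank_on_def fin_dim_def)
  thus ?thesis
    unfolding corner_module_def
    by (subst rank_invariant_inclusion_module[OF vs corner_in_grid]) auto
qed

text \<open>The operator adds up at \<open>r\<close> what arrives from \<open>p\<close> and
  \<open>q\<close>. Its image is thus the sum of two spans, placed at \<open>r\<close>, and this sum
  does see their relative position.\<close>

lemma jordan_rank_1_corner_module: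
  assumes vs: "vector_space s" and fin: "\<And>x. finite (G x)" and G: "G p \<union> G q \<subseteq> G r"
  shows "jordan_rank 1 (zero_extension {0..l} (corner_module s G)) (grid_layers l) 0 0 =
    enat (vector_space.dim s (G p \<union> G q))"
proof -
  interpret vector_space s by fact
  let ?M = "zero_extension {0..l} (corner_module s G)" and ?S = "grid_layers l"
  let ?J = "jordan_module 1 ?M ?S"
  have "0 \<le> l" using l by (auto simp: less_eq_vec_def order_trans[OF zero_le_one])
  note Z = Union_grid_layers[OF this]
  have M: "poset_module UNIV ?M"
    by (rule poset_module_zero_extension[OF poset_module_corner_module[where P = "{0..l}", OF vs G] grid_convex])
  have fib: "fibre ?M x = (if x \<in> {p, q, r} then span (G x) else {0})" for x
    using corner_in_grid by (auto simp: zero_extension_def corner_module_def inclusion_module_def)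
  have map: "smap ?M y x v = (if x \<in> {0..l} \<and> y \<in> {p, q, r} then v else 0)" for x y v
    using corner_in_grid by (auto simp: zero_extension_def corner_module_def inclusion_module_def)
  have T: "nilp_op ?M ?S f = (\<lambda>y. if y = r then f p + f q else 0)"
    if f: "f \<in> direct_sum ?M ?S" for f
  proof
    fix y
    have f0: "f x = 0" if "x \<notin> {p, q, r}" for x
      using f that unfolding direct_sum_def mem_Collect_eq fib by (metis singletonD)
    show "nilp_op ?M ?S f y = (if y = r then f p + f q else 0)"
    proof (cases "y \<in> {0..l}")
      case False
      thus ?thesis using corner_in_grid nilp_op_outside[of y ?S] by (auto simp: Z)
    next
      case y: True
      let ?X = "{x. x \<in> {0..l} \<and> (\<Sum>j\<in>UNIV. x $ j) + 1 = (\<Sum>j\<in>UNIV. y $ j)}"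
      let ?t = "\<lambda>x. if x < y then smap ?M y x (f x) else 0"
      \<comment> \<open>A nonzero term has both ends in the corner: \<open>f\<close> vanishes at
        other sources and the structure map at other targets. A strict relation there ends in
        \<open>r\<close>.\<close>
      have t0: "?t x = 0" if "\<not> (y = r \<and> x \<in> {p, q})" for x
        using that f0[of x] corner_le by (auto simp: map less_le_not_le)
      have "finite ?X" by (rule finite_subset[OF _ finite_grid[of l]]) auto
      show ?thesis
      proof (cases "y = r")
        case True
        have "sum ?t ?X = sum ?t {p, q}"
          using \<open>finite ?X\<close> corner_in_grid t0
          by (intro sum.mono_neutral_right) (auto simp: True size_corner)
        also have "\<dots> = f p + f q"
          using distinct_corner corner_le corner_in_grid by (simp add: map True less_le_not_le)
        finally have "nilp_op ?M ?S f y = f p + f q"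
          by (simp only: nilp_op_grid_layers[OF y])
        thus ?thesis by (simp only: if_P[OF True])
      next
        case False
        hence "sum ?t ?X = 0" using t0 by (intro sum.neutral) blast
        hence "nilp_op ?M ?S f y = 0"
          by (simp only: nilp_op_grid_layers[OF y])
        thus ?thesis by (simp only: if_not_P[OF False])
      qed
    qed
  qed
  have fibJ: "fibre ?J 0 = dsum {r} (\<lambda>_. span (G p \<union> G q))"
  proof -
    have "shift 0 ?M = ?M" by (simp add: shift_def)
    hence "fibre ?J 0 = nilp_op ?M ?S ` direct_sum ?M ?S"
      by (simp add: jordan_module_def)
    also have "\<dots> = (\<lambda>f y. if y = r then f p + f q else 0) ` direct_sum ?M ?S"
      using T by (rule image_cong[OF refl])
    also have "\<dots> = dsum {r} (\<lambda>_. span (G p \<union> G q))"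
    proof (intro equalityI subsetI)
      fix g assume "g \<in> (\<lambda>f y. if y = r then f p + f q else 0) ` direct_sum ?M ?S"
      then obtain f where f: "f \<in> direct_sum ?M ?S" "g = (\<lambda>y. if y = r then f p + f q else 0)"
        by blast
      have "f p \<in> fibre ?M p" "f q \<in> fibre ?M q"
        using f(1) corner_in_grid unfolding direct_sum_def Z by blast+
      hence "f p \<in> span (G p)" "f q \<in> span (G q)" by (simp_all add: fib)
      thus "g \<in> dsum {r} (\<lambda>_. span (G p \<union> G q))"
        using f(2) by (auto simp: dsum_def span_Un)
    next
      fix g assume g: "g \<in> dsum {r} (\<lambda>_. span (G p \<union> G q))"
      then obtain v w where vw: "v \<in> span (G p)" "w \<in> span (G q)" "g r = v + w"
        by (auto simp: dsum_def span_Un)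
      define f where "f x = (if x = p then v else if x = q then w else 0)" for x
      have "f \<in> direct_sum ?M ?S"
        using vw(1,2) distinct_corner corner_in_grid
        by (auto simp: direct_sum_eq_dsum dsum_def Z fib span_zero f_def)
      moreover have "g = (\<lambda>y. if y = r then f p + f q else 0)"
        using g vw(3) distinct_corner by (auto simp: dsum_def fun_eq_iff f_def)
      ultimately show "g \<in> (\<lambda>f y. if y = r then f p + f q else 0) ` direct_sum ?M ?S"
        by blast
    qed
    finally show ?thesis .
  qed
  \<comment> \<open>On the diagonal the structure map is the identity, so the rank is the dimension
    of the fibre.\<close>
  have "smap ?J 0 0 f = f" if "f \<in> fibre ?J 0" for f
    using poset_module_jordan_module[OF M] that unfolding poset_module_def by blast
  hence "smap ?J 0 0 ` fibre ?J 0 = fibre ?J 0" by simp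
  moreover have "fin_dim s (span (G p \<union> G q))"
    using fin unfolding fin_dim_def by blast
  moreover have "scalar ?J = (\<lambda>c f z. s c (f z))"
    by (simp add: jordan_module_def zero_extension_def corner_module_def inclusion_module_def)
  ultimately show ?thesis
    using dim_dsum[OF vs, of "{r}" "\<lambda>_. span (G p \<union> G q)"]
    by (simp add: jordan_rank_def rank_invariant_def rank_on_def fibJ del: One_nat_def)
qed

end

section \<open>Two independent vectors in the space of sequences over the field\<close>

definition fscale :: "'k::field \<Rightarrow> (nat \<Rightarrow> 'k) \<Rightarrow> nat \<Rightarrow> 'k" where
  "fscale c f = (\<lambda>n. c * f n)"

definition unit_fun :: "nat \<Rightarrow> nat \<Rightarrow> 'k::field" where
  "unit_fun n = (\<lambda>i. if i = n then 1 else 0)"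

lemma vector_space_fscale: "vector_space (fscale :: 'k::field \<Rightarrow> _)"
  by unfold_locales (auto simp: fscale_def fun_eq_iff algebra_simps)

lemma unit_fun_neq: "unit_fun 0 \<noteq> (unit_fun 1 :: nat \<Rightarrow> 'k::field)"
  using fun_cong[of "unit_fun 0" "unit_fun 1" 0] by (auto simp: unit_fun_def)

lemma independent_unit_fun:
  "\<not> module.dependent fscale {unit_fun 0, unit_fun 1 :: nat \<Rightarrow> 'k::field}"
proof -
  interpret vector_space "fscale :: 'k \<Rightarrow> _" by (rule vector_space_fscale)
  show ?thesis
  proof (rule independent_if_scalars_zero)
    fix c :: "(nat \<Rightarrow> 'k) \<Rightarrow> 'k" and x :: "nat \<Rightarrow> 'k"
    assume "(\<Sum>v\<in>{unit_fun 0, unit_fun 1}. fscale (c v) v) = 0" and x: "x \<in> {unit_fun 0, unit_fun 1}"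
    hence eq: "fscale (c (unit_fun 0)) (unit_fun 0) + fscale (c (unit_fun 1)) (unit_fun 1) = 0"
      using unit_fun_neq[where 'k = 'k] by simp
    show "c x = 0"
      using fun_cong[OF eq, of 0] fun_cong[OF eq, of 1] x
      by (auto simp: fscale_def unit_fun_def)
  qed simp
qed

lemma dim_unit_fun:
  "vector_space.dim fscale {unit_fun 0, unit_fun 1 :: nat \<Rightarrow> 'k::field} = 2"
  "vector_space.dim fscale {unit_fun 0 :: nat \<Rightarrow> 'k} = 1"
  "vector_space.dim fscale {unit_fun 1 :: nat \<Rightarrow> 'k} = 1"
proof -
  interpret vector_space "fscale :: 'k \<Rightarrow> _" by (rule vector_space_fscale)
  have "dim B = card B" if "B \<subseteq> {unit_fun 0, unit_fun 1 :: nat \<Rightarrow> 'k}" for B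
    using independent_mono[OF independent_unit_fun that] by (rule dim_eq_card_independent)
  thus "dim {unit_fun 0, unit_fun 1 :: nat \<Rightarrow> 'k} = 2" "dim {unit_fun 0 :: nat \<Rightarrow> 'k} = 1"
    "dim {unit_fun 1 :: nat \<Rightarrow> 'k} = 1"
    using unit_fun_neq[where 'k = 'k] by auto
qed

section \<open>Two modules with equal ranks and different first Jordan rank\<close>

context corner
begin

text \<open>On the corner this differs from \<open>aligned\<close> at \<open>q\<close> only, where
  the line is transversal to the one at \<open>p\<close> instead of equal to it.\<close>

definition spread :: "int^'d \<Rightarrow> (nat \<Rightarrow> 'k::field) set" where
  "spread x = (if x = p then {unit_fun 0} else if x = q then {unit_fun 1} else {unit_fun 0, unit_fun 1})"

definition aligned :: "int^'d \<Rightarrow> (nat \<Rightarrow> 'k::field) set" where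
  "aligned x = (if x = r then {unit_fun 0, unit_fun 1} else {unit_fun 0})"

text \<open>By naturality, an isomorphism would send both basis vectors of the plane at
  \<open>r\<close>, which come from \<open>p\<close> and \<open>q\<close>, into one and the same
  line. A plane does not embed linearly into a line.\<close>

lemma not_isomorphic:
  "\<not> module_isomorphic {0..l} (corner_module fscale spread)
      (corner_module (fscale :: 'k::field \<Rightarrow> _) aligned)"
proof
  interpret vector_space "fscale :: 'k \<Rightarrow> _" by (rule vector_space_fscale)
  let ?X = "corner_module (fscale :: 'k \<Rightarrow> _) spread"
    and ?Y = "corner_module (fscale :: 'k \<Rightarrow> _) aligned"
  let ?e = "unit_fun :: nat \<Rightarrow> nat \<Rightarrow> 'k"
  have X: "fibre ?X p = span {?e 0}" "fibre ?X q = span {?e 1}" "fibre ?X r = span {?e 0, ?e 1}"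
    and Y: "fibre ?Y p = span {?e 0}" "fibre ?Y q = span {?e 0}"
    and maps: "smap ?X r x v = v" "smap ?Y r x v = v" and sc: "scalar ?X = fscale" "scalar ?Y = fscale"
    for x v
    using distinct_corner
    by (auto simp: corner_module_def inclusion_module_def spread_def aligned_def)
  assume "module_isomorphic {0..l} ?X ?Y"
  then obtain \<phi> where
    iso: "\<forall>x\<in>{0..l}. linear_between fscale fscale (fibre ?X x) (fibre ?Y x) (\<phi> x) \<and>
      bij_betw (\<phi> x) (fibre ?X x) (fibre ?Y x)"
    and natural: "\<forall>x\<in>{0..l}. \<forall>y\<in>{0..l}. x \<le> y \<longrightarrow>
      (\<forall>v\<in>fibre ?X x. \<phi> y (smap ?X y x v) = smap ?Y y x (\<phi> x v))"
    unfolding module_isomorphic_def sc by (elim exE conjE)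
  note lin = iso[rule_format, THEN conjunct1] and bij = iso[rule_format, THEN conjunct2]
  have in_grid: "p \<in> {0..l}" "q \<in> {0..l}" "r \<in> {0..l}" using corner_in_grid by auto
  have "\<phi> r (?e 0) = \<phi> p (?e 0)" "\<phi> p (?e 0) \<in> span {?e 0}"
    using natural[rule_format, OF in_grid(1,3) corner_le(1), of "?e 0"] lin[OF in_grid(1)]
    by (auto simp: X Y maps linear_between_def span_base)
  then obtain \<alpha> where \<alpha>: "\<phi> r (?e 0) = fscale \<alpha> (?e 0)"
    by (auto simp: span_singleton)
  have "\<phi> r (?e 1) = \<phi> q (?e 1)" "\<phi> q (?e 1) \<in> span {?e 0}"
    using natural[rule_format, OF in_grid(2,3) corner_le(2), of "?e 1"] lin[OF in_grid(2)]
    by (auto simp: X Y maps linear_between_def span_base)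
  then obtain \<beta> where \<beta>: "\<phi> r (?e 1) = fscale \<beta> (?e 0)"
    by (auto simp: span_singleton)
  let ?V = "span {?e 0, ?e 1}"
  have V: "?e 0 \<in> ?V" "?e 1 \<in> ?V" by (auto intro: span_base)
  have add: "\<phi> r (u + v) = \<phi> r u + \<phi> r v" and scl: "\<phi> r (fscale c u) = fscale c (\<phi> r u)"
    if "u \<in> ?V" "v \<in> ?V" for u v c
    using lin[OF in_grid(3)] that by (auto simp: X linear_between_def)
  have inj: "u = v" if "u \<in> ?V" "v \<in> ?V" "\<phi> r u = \<phi> r v" for u v
    using bij[OF in_grid(3)] that by (auto simp: X bij_betw_def inj_on_def)
  \<comment> \<open>Cross-multiplying the coefficients produces two vectors with the same image,
    \<open>\<alpha> * \<beta>\<close> times \<open>?e 0\<close>.\<close>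
  have "\<phi> r (fscale \<beta> (?e 0)) = \<phi> r (fscale \<alpha> (?e 1))"
    by (simp only: scl[OF V] scl[OF V(2,1)] \<alpha> \<beta> scale_scale mult.commute)
  hence eq: "fscale \<beta> (?e 0) = fscale \<alpha> (?e 1)"
    by (rule inj[OF span_scale[OF V(1)] span_scale[OF V(2)]])
  \<comment> \<open>Coordinate 1 separates the two sides; then \<open>?e 0\<close> lies in the
    kernel of the injective map.\<close>
  have "\<alpha> = 0" using fun_cong[OF eq, of 1] by (simp add: fscale_def unit_fun_def)
  hence "\<phi> r (?e 0) = \<phi> r 0"
    using scl[OF V, of 0] by (simp add: \<alpha>)
  hence e0: "?e 0 = 0" by (rule inj[OF V(1) span_zero])
  show False using fun_cong[OF e0, of 0] by (simp add: unit_fun_def)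
qed

text \<open>Dimensions agree at all three corner points, so the rank invariants coincide, whereas
  the generators at \<open>p\<close> and \<open>q\<close> jointly span a plane for
  \<open>spread\<close> and a line for \<open>aligned\<close>.\<close>

lemma separating_pair:
  "\<exists>(X :: ('k::field, int^'d, nat \<Rightarrow> 'k) pmod) (Y :: ('k, int^'d, nat \<Rightarrow> 'k) pmod).
     poset_module {0..l} X \<and> pointwise_fin_dim {0..l} X \<and>
     poset_module {0..l} Y \<and> pointwise_fin_dim {0..l} Y \<and>
     \<not> module_isomorphic {0..l} X Y \<and>
     jordan_rank 1 (zero_extension {0..l} X) (grid_layers l) 0 0 \<noteq>
       jordan_rank 1 (zero_extension {0..l} Y) (grid_layers l) 0 0 \<and>
     rank_invariant (zero_extension {0..l} X) = rank_invariant (zero_extension {0..l} Y)"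
proof -
  let ?X = "corner_module (fscale :: 'k \<Rightarrow> _) spread"
    and ?Y = "corner_module (fscale :: 'k \<Rightarrow> _) aligned"
  note vs = vector_space_fscale[where 'k = 'k]
  have fin: "finite (spread x :: (nat \<Rightarrow> 'k) set)" "finite (aligned x :: (nat \<Rightarrow> 'k) set)" for x
    by (simp_all add: spread_def aligned_def)
  have sub: "spread p \<union> spread q \<subseteq> (spread r :: (nat \<Rightarrow> 'k) set)"
    "aligned p \<union> aligned q \<subseteq> (aligned r :: (nat \<Rightarrow> 'k) set)"
    using distinct_corner by (auto simp: spread_def aligned_def)
  have Un: "spread p \<union> spread q = {unit_fun 0, unit_fun 1 :: nat \<Rightarrow> 'k}"
    "aligned p \<union> aligned q = {unit_fun 0 :: nat \<Rightarrow> 'k}"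
    using distinct_corner by (auto simp: spread_def aligned_def)
  have "vector_space.dim fscale (spread x :: (nat \<Rightarrow> 'k) set) =
      vector_space.dim fscale (aligned x :: (nat \<Rightarrow> 'k) set)" if "x \<in> {p, q, r}" for x
    using that distinct_corner
    by (auto simp: spread_def aligned_def dim_unit_fun dim_unit_fun[unfolded One_nat_def])
  hence "rank_invariant (zero_extension {0..l} ?X) = rank_invariant (zero_extension {0..l} ?Y)"
    by (intro ext) (simp add: rank_invariant_corner_module[OF vs fin(1)]
        rank_invariant_corner_module[OF vs fin(2)])
  moreover have "jordan_rank 1 (zero_extension {0..l} ?X) (grid_layers l) 0 0 = enat 2"
    using jordan_rank_1_corner_module[OF vs fin(1) sub(1)] by (simp only: Un dim_unit_fun)
  moreover have "jordan_rank 1 (zero_extension {0..l} ?Y) (grid_layers l) 0 0 = enat 1"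
    using jordan_rank_1_corner_module[OF vs fin(2) sub(2)] by (simp only: Un dim_unit_fun)
  ultimately show ?thesis
    using poset_module_corner_module[OF vs sub(1), of "{0..l}"]
      poset_module_corner_module[OF vs sub(2), of "{0..l}"]
      pointwise_fin_dim_corner_module[OF vs fin(1), of "{0..l}"]
      pointwise_fin_dim_corner_module[OF vs fin(2), of "{0..l}"] not_isomorphic
    by (intro exI[of _ ?X] exI[of _ ?Y]) simp
qed

end

theorem proposition18:
  fixes l :: "int^'d::finite"
  assumes "\<forall>j. 1 \<le> l $ j"
  shows
    "(\<forall>(M :: ('k::field, int^'d, 'a::ab_group_add) pmod)
       (N :: ('k, int^'d, 'b::ab_group_add) pmod).
        poset_module {0..l} M \<and> pointwise_fin_dim {0..l} M \<and>
        poset_module {0..l} N \<and> pointwise_fin_dim {0..l} N \<longrightarrow>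
        (jordan_rank 0 (zero_extension {0..l} M) (grid_layers l) =
           jordan_rank 0 (zero_extension {0..l} N) (grid_layers l) \<longleftrightarrow>
         rank_invariant (zero_extension {0..l} M) =
           rank_invariant (zero_extension {0..l} N)))
     \<and>
     (CARD('d) \<ge> 2 \<longrightarrow>
      (\<exists>(X :: ('k, int^'d, nat \<Rightarrow> 'k) pmod) (Y :: ('k, int^'d, nat \<Rightarrow> 'k) pmod).
        poset_module {0..l} X \<and> pointwise_fin_dim {0..l} X \<and>
        poset_module {0..l} Y \<and> pointwise_fin_dim {0..l} Y \<and>
        \<not> module_isomorphic {0..l} X Y \<and>
        jordan_rank 1 (zero_extension {0..l} X) (grid_layers l) 0 0 \<noteq>
          jordan_rank 1 (zero_extension {0..l} Y) (grid_layers l) 0 0 \<and>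
        rank_invariant (zero_extension {0..l} X) =
          rank_invariant (zero_extension {0..l} Y)))"
proof (intro conjI allI impI)
  fix M :: "('k, int^'d, 'a) pmod" and N :: "('k, int^'d, 'b) pmod"
  assume "poset_module {0..l} M \<and> pointwise_fin_dim {0..l} M \<and>
    poset_module {0..l} N \<and> pointwise_fin_dim {0..l} N"
  moreover have "0 \<le> l" using assms by (auto simp: less_eq_vec_def order_trans[OF zero_le_one])
  ultimately show "jordan_rank 0 (zero_extension {0..l} M) (grid_layers l) =
      jordan_rank 0 (zero_extension {0..l} N) (grid_layers l) \<longleftrightarrow>
    rank_invariant (zero_extension {0..l} M) = rank_invariant (zero_extension {0..l} N)"
    by (intro jordan_rank_0_eq_iff) auto
next
  assume "CARD('d) \<ge> 2"
  \<comment> \<open>Two distinct elements of the index type serve as the two axes of the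
    corner.\<close>
  then obtain a b :: 'd where "a \<noteq> b"
    using card_le_Suc0_iff_eq[of "UNIV :: 'd set"] by fastforce
  then interpret corner a b l using assms by unfold_locales
  show "\<exists>(X :: ('k, int^'d, nat \<Rightarrow> 'k) pmod) (Y :: ('k, int^'d, nat \<Rightarrow> 'k) pmod).
     poset_module {0..l} X \<and> pointwise_fin_dim {0..l} X \<and>
     poset_module {0..l} Y \<and> pointwise_fin_dim {0..l} Y \<and>
     \<not> module_isomorphic {0..l} X Y \<and>
     jordan_rank 1 (zero_extension {0..l} X) (grid_layers l) 0 0 \<noteq>
       jordan_rank 1 (zero_extension {0..l} Y) (grid_layers l) 0 0 \<and>
     rank_invariant (zero_extension {0..l} X) = rank_invariant (zero_extension {0..l} Y)"
    by (rule separating_pair)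
qed

end
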